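(* Let $N$ reader antennas have known positions and orientation angles, let $\mathbf{x}=[{\rm x}_1,{\rm x}_2]=[x,y]$ be the unknown planar location of a tag, and let $P_{ij}$ and $C_{ij}(x,y)$ be the received power (in dBm) and the coverage indicator for the antenna pair $(i,j)$, as defined in the context. Let the measurements be $$\hat{\mathbf{p}}=\mathbf{p}+\boldsymbol{\omega},\qquad \boldsymbol{\omega}=[\omega_{11},\dots,\omega_{ij},\dots,\omega_{NN}]^T,\qquad \omega_{ij}\sim\mathcal{N}(0,\sigma^2)\ \text{i.i.d.},\quad i,j=1,\dots,N,$$ where $\mathbf{p}$ is the vector of the $N^2$ true values $P_{ij}$ and $\hat{\mathbf{p}}$ is the vector of the measured values $\hat P_{ij}$, and let the likelihood function be $$\mathcal{L}(\hat{\mathbf{p}};\mathbf{x})=\frac{1}{(2\pi\sigma^2)^{N^2/2}}\exp\left(-\frac{1}{2\sigma^2}\sum_{i=1}^{N}\sum_{j=1}^{N}C_{ij}(x,y)\left(P_{ij}-\hat P_{ij}\right)^2\right).$$ Then the Cramer-Rao lower bound on the root mean square error (RMSE) of an unbiased position estimator $\hat{\mathbf{x}}$ based on this measurement model and this likelihood function is given by $$\mathrm{RMSE}_{\rm loc}(x,y)\ \ge\ \sqrt{\mathbf{I}^{-1}_{11}+\mathbf{I}^{-1}_{22}}\,,$$ where $\mathbf{I}^{-1}_{11},\mathbf{I}^{-1}_{22}$ are the diagonal entries of the inverse of the Fisher information matrix for $\mathbf{x}$, $$\mathbf{I}(\mathbf{x})=\begin{bmatrix}\mathbf{I}_{11}&\mathbf{I}_{12}\\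 \mathbf{I}_{21}&\mathbf{I}_{22}\end{bmatrix},$$ whose elements, for $m,n=1,2$, are $$\mathbf{I}_{mn}=-E\left[\frac{\partial^2\ln\mathcal{L}(\hat{\mathbf{p}};\mathbf{x})}{\partial {\rm x}_m\,\partial {\rm x}_n}\right]=\frac{1}{\sigma^2}\sum_{i=1}^{N}\sum_{j=1}^{N}\left(\frac{\partial\hat P_{ij}}{\partial {\rm x}_m}\times\frac{\partial\hat P_{ij}}{\partial {\rm x}_n}\right).$$ Here $\partial\hat P_{ij}/\partial{\rm x}_m$ denotes the partial derivative of the received-power expression $P_{ij}$ given in the context, written as $$\frac{\partial\hat P_{ij}}{\partial {\rm x}_m}=\frac{\partial\big(20\log_{10}(\tau\mu_{\rm T}\rho_{\rm L}P_{\rm Tx}G_{\rm T}^2|h_ih_j\Gamma|^2)\big)}{\partial {\rm x}_m}+\frac{\partial(20\log_{10}G_{\rm R}^i)}{\partial {\rm x}_m}+\frac{\partial(20\log_{10}G_{\rm R}^j)}{\partial {\rm x}_m}+\frac{\partial(20\log_{10}L(d_i))}{\partial {\rm x}_m}+\frac{\partial(20\log_{10}L(d_j))}{\partial {\rm x}_m},$$ and, since $\tau\mu_{\rm T}\rho_{\rm L}P_{\rm Tx}G_{\rm T}^2|h_ih_j\Gamma|^2$ is not affected by the tag location, given by $$\frac{\partial\hat P_{ij}}{\partial {\rm x}_m}=\frac{20}{\ln 10}\left(\frac{\partial G_{\rm R}^i}{\partial {\rm x}_m}+\frac{\partial G_{\rm R}^j}{\partial {\rm x}_m}+\frac{\partial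 L(d_i)}{\partial {\rm x}_m}+\frac{\partial L(d_j)}{\partial {\rm x}_m}\right).$$
   Context: Bistatic passive UHF RFID received-signal-strength model. Reader antenna $i$ ($i=1,\dots,N$) is at $(x_i,y_i,z_i)$, with elevation angle $\theta_i$ and azimuthal angle $\phi_i$. The tag is at $(x_0,y_0,z_0)$, where $(x_0,y_0)$ is the unknown location $\mathbf{x}=[x,y]$ and the height $z_0$ is known. Set $$d_i=\sqrt{(x_0-x_i)^2+(y_0-y_i)^2+(z_0-z_i)^2},\qquad l_i=\sqrt{(x_0-x_i)^2+(y_0-y_i)^2}.$$ Path loss: $L(d_i)=\big(\lambda/(4\pi d_i)\big)^2$, where $\lambda$ is the wavelength. Directional gain of reader antenna $i$: $$G_{\rm R}^i=3.136\left(\frac{\tan\theta_i-\frac{z_i-z_0}{d_i}}{1-\frac{z_i-z_0}{d_i}\tan\theta_i}\right)^2\sin^2\!\left(\frac{\pi}{2}\Big(\frac{l_i}{d_i}\cos\theta_i+\frac{z_i-z_0}{d_i}\sin\theta_i\Big)\right)$$ $$\times\cos^2\!\left(\frac{\pi}{2}\Big(\frac{l_i}{d_i}\sin\theta_i-\frac{z_i-z_0}{d_i}\cos\theta_i\Big)\frac{(x_i-x_0)\cos\phi_i+(y_i-y_0)\sin\phi_i}{l_i}\right).$$ Parameters not affected by the tag location: $\tau$ (data encoding modulation coefficient), $\mu_{\rm T}\in[0,1]$ (power transfer efficiency), $\rho_{\rm L}$ (polarization loss factor), $P_{\rm Tx}$ (effective isotropic radiated power of the reader antenna), $G_{\rm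 T}$ (tag antenna gain), $h_i,h_j$ (forward-link and backscatter-link channels) and $\Gamma$ (differential reflection coefficient of the tag). Received power (in dBm) when antenna $i$ transmits and antenna $j$ receives the backscattered signal: $$P_{ij}=20\log_{10}\!\big(\tau\mu_{\rm T}\rho_{\rm L}P_{\rm Tx}G_{\rm T}^2|h_ih_j\Gamma|^2\big)+20\log_{10}G_{\rm R}^i+20\log_{10}G_{\rm R}^j+20\log_{10}L(d_i)+20\log_{10}L(d_j).$$ Received power (in dBm) at the tag from antenna $i$: $$P_i=20\log_{10}\!\big(\rho_{\rm L}P_{\rm Tx}G_{\rm T}G_{\rm R}^iL(d_i)|h_i|^2\big).$$ Coverage indicator (reader and tag sensitivity): $C_{ij}(x,y)=1$ if $P_{ij}\ge -75$ dBm and $P_i\ge -20$ dBm, and $C_{ij}(x,y)=0$ otherwise.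
   Formalization: The last display needs each derivative divided by its G_R or L(d). -E[∂² ln L] equals the sum weighted by C_ij (the printed sum if all C_ij=1). The bound with that matrix is for estimators using covered data only; with the printed sum, for all. Positive parameters and x off singularities assumed. *)

theory Defs
  imports "HOL-Probability.Probability"
begin

text \<open>The index type \<open>'n\<close> enumerates the \<open>N = CARD('n)\<close> reader antennas.  Channels and the
  differential reflection coefficient are complex; all other parameters are on a linear scale.\<close>

record 'n rfid =
  apos :: "'n \<Rightarrow> real ^ 3"
  elev :: "'n \<Rightarrow> real"
  azim :: "'n \<Rightarrow> real"
  tag_z :: real
  wavelen :: real
  tau :: real
  muT :: real
  rhoL :: real
  PTx :: real
  GT :: real
  chan :: "'n \<Rightarrow> complex"
  refl_coeff :: complex

text \<open>The logarithms in the received powers are meaningful only for positive parameters; this is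
  why \<open>muT\<close>, which ranges over the unit interval, is required to be nonzero.\<close>

definition admissible :: "'n rfid \<Rightarrow> bool" where
  "admissible R \<longleftrightarrow> 0 < wavelen R \<and> 0 < tau R \<and> 0 < muT R \<and> muT R \<le> 1 \<and> 0 < rhoL R \<and>
     0 < PTx R \<and> 0 < GT R \<and> (\<forall>i. chan R i \<noteq> 0) \<and> refl_coeff R \<noteq> 0"

definition ldist :: "'n rfid \<Rightarrow> 'n \<Rightarrow> real ^ 2 \<Rightarrow> real" where
  "ldist R i u = sqrt ((u $ 1 - apos R i $ 1)\<^sup>2 + (u $ 2 - apos R i $ 2)\<^sup>2)"

definition ddist :: "'n rfid \<Rightarrow> 'n \<Rightarrow> real ^ 2 \<Rightarrow> real" where
  "ddist R i u =
     sqrt ((u $ 1 - apos R i $ 1)\<^sup>2 + (u $ 2 - apos R i $ 2)\<^sup>2 + (tag_z R - apos R i $ 3)\<^sup>2)"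

definition path_loss :: "'n rfid \<Rightarrow> real \<Rightarrow> real" where
  "path_loss R d = (wavelen R / (4 * pi * d))\<^sup>2"

definition gainR :: "'n rfid \<Rightarrow> 'n \<Rightarrow> real ^ 2 \<Rightarrow> real" where
  "gainR R i u =
    (let d = ddist R i u; l = ldist R i u; s = (apos R i $ 3 - tag_z R) / d;
         \<theta> = elev R i; \<phi> = azim R i
     in 3.136 * ((tan \<theta> - s) / (1 - s * tan \<theta>))\<^sup>2
        * (sin (pi / 2 * (l / d * cos \<theta> + s * sin \<theta>)))\<^sup>2
        * (cos (pi / 2 * (l / d * sin \<theta> - s * cos \<theta>)
              * (((apos R i $ 1 - u $ 1) * cos \<phi> + (apos R i $ 2 - u $ 2) * sin \<phi>) / l)))\<^sup>2)"

definition link_const :: "'n rfid \<Rightarrow> 'n \<Rightarrow> 'n \<Rightarrow> real" where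
  "link_const R i j =
     tau R * muT R * rhoL R * PTx R * (GT R)\<^sup>2 * (cmod (chan R i * chan R j * refl_coeff R))\<^sup>2"

definition rx_power :: "'n rfid \<Rightarrow> 'n \<Rightarrow> 'n \<Rightarrow> real ^ 2 \<Rightarrow> real" where
  "rx_power R i j u =
     20 * log 10 (link_const R i j)
     + 20 * log 10 (gainR R i u) + 20 * log 10 (gainR R j u)
     + 20 * log 10 (path_loss R (ddist R i u)) + 20 * log 10 (path_loss R (ddist R j u))"

definition tag_power :: "'n rfid \<Rightarrow> 'n \<Rightarrow> real ^ 2 \<Rightarrow> real" where
  "tag_power R i u =
     20 * log 10 (rhoL R * PTx R * GT R * gainR R i u * path_loss R (ddist R i u)
                  * (cmod (chan R i))\<^sup>2)"

definition coverage :: "'n rfid \<Rightarrow> 'n \<Rightarrow> 'n \<Rightarrow> real ^ 2 \<Rightarrow> real" where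
  "coverage R i j u = (if rx_power R i j u \<ge> -75 \<and> tag_power R i u \<ge> -20 then 1 else 0)"

text \<open>Locations where the received powers are well defined and smooth: no antenna vertically above
  the tag (the gain divides by \<open>l\<^sub>i\<close>), and no vanishing gain (the power is its logarithm).  A zero
  denominator in the first factor of the gain makes the gain 0 and is excluded as well.\<close>

definition regular_at :: "'n rfid \<Rightarrow> real ^ 2 \<Rightarrow> bool" where
  "regular_at R x \<longleftrightarrow> (\<forall>i. ldist R i x \<noteq> 0 \<and> gainR R i x \<noteq> 0)"

definition power_vec :: "'n::finite rfid \<Rightarrow> real ^ 2 \<Rightarrow> real ^ ('n \<times> 'n)" where
  "power_vec R u = (\<chi> k. rx_power R (fst k) (snd k) u)"

definition measured ::
  "'n::finite rfid \<Rightarrow> ('n \<times> 'n \<Rightarrow> 'a \<Rightarrow> real) \<Rightarrow> real ^ 2 \<Rightarrow> 'a \<Rightarrow> real ^ ('n \<times> 'n)" where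
  "measured R \<omega> u w = power_vec R u + (\<chi> k. \<omega> k w)"

definition gaussian_noise :: "'a measure \<Rightarrow> real \<Rightarrow> ('k \<Rightarrow> 'a \<Rightarrow> real) \<Rightarrow> bool" where
  "gaussian_noise M \<sigma> \<omega> \<longleftrightarrow>
     prob_space.indep_vars M (\<lambda>_. borel) \<omega> UNIV \<and>
     (\<forall>k. distributed M lborel (\<omega> k) (normal_density 0 \<sigma>))"

definition likelihood ::
  "'n::finite rfid \<Rightarrow> real \<Rightarrow> real ^ ('n \<times> 'n) \<Rightarrow> real ^ 2 \<Rightarrow> real" where
  "likelihood R \<sigma> p u =
     1 / (2 * pi * \<sigma>\<^sup>2) powr (real (CARD('n)\<^sup>2) / 2)
     * exp (- (1 / (2 * \<sigma>\<^sup>2))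
            * (\<Sum>i\<in>UNIV. \<Sum>j\<in>UNIV. coverage R i j u * (rx_power R i j u - p $ (i, j))\<^sup>2))"

definition partial :: "'m::finite \<Rightarrow> (real ^ 'm \<Rightarrow> real) \<Rightarrow> real ^ 'm \<Rightarrow> real" where
  "partial m f u = deriv (\<lambda>t. f (u + t *\<^sub>R axis m 1)) 0"

text \<open>The data are generated at the true location \<open>x\<close>; the likelihood is differentiated in its
  location argument and evaluated at \<open>x\<close>.\<close>

definition fisher ::
  "'n::finite rfid \<Rightarrow> real \<Rightarrow> 'a measure \<Rightarrow> ('n \<times> 'n \<Rightarrow> 'a \<Rightarrow> real) \<Rightarrow> real ^ 2 \<Rightarrow> real ^ 2 ^ 2" where
  "fisher R \<sigma> M \<omega> x =
     (\<chi> m n. - (\<integral>w. partial m (partial n (\<lambda>u. ln (likelihood R \<sigma> (measured R \<omega> x w) u))) x \<partial>M))"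

text \<open>Closed form of the information carried by all \<open>N\<^sup>2\<close> measurements, covered or not.\<close>

definition info_all :: "'n::finite rfid \<Rightarrow> real \<Rightarrow> real ^ 2 \<Rightarrow> real ^ 2 ^ 2" where
  "info_all R \<sigma> x =
     (\<chi> m n. 1 / \<sigma>\<^sup>2 * (\<Sum>i\<in>UNIV. \<Sum>j\<in>UNIV.
        partial m (rx_power R i j) x * partial n (rx_power R i j) x))"

definition unbiased_on ::
  "'n::finite rfid \<Rightarrow> 'a measure \<Rightarrow> ('n \<times> 'n \<Rightarrow> 'a \<Rightarrow> real) \<Rightarrow> (real ^ 2) set
     \<Rightarrow> (real ^ ('n \<times> 'n) \<Rightarrow> real ^ 2) \<Rightarrow> bool" where
  "unbiased_on R M \<omega> S est \<longleftrightarrow>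
     (\<forall>u\<in>S. integrable M (\<lambda>w. est (measured R \<omega> u w)) \<and> (\<integral>w. est (measured R \<omega> u w) \<partial>M) = u)"

text \<open>The likelihood at \<open>x\<close> ignores the measurements of pairs that are not covered; an estimator
  based on it sees only the covered ones.  If all pairs are covered, this holds for every
  estimator.\<close>

definition uses_covered ::
  "'n::finite rfid \<Rightarrow> real ^ 2 \<Rightarrow> (real ^ ('n \<times> 'n) \<Rightarrow> real ^ 2) \<Rightarrow> bool" where
  "uses_covered R x est \<longleftrightarrow>
     (\<forall>p q. (\<forall>i j. coverage R i j x = 1 \<longrightarrow> p $ (i, j) = q $ (i, j)) \<longrightarrow> est p = est q)"

text \<open>The error may have an infinite second moment, in which case the RMSE is infinite.\<close>

definition rmse :: "'a measure \<Rightarrow> ('a \<Rightarrow> real ^ 2) \<Rightarrow> real ^ 2 \<Rightarrow> ennreal" where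
  "rmse M X x =
     (let mse = \<integral>\<^sup>+w. ennreal ((norm (X w - x))\<^sup>2) \<partial>M
      in if mse = \<infinity> then \<infinity> else ennreal (sqrt (enn2real mse)))"

end

theory Submission
  imports Defs
begin

text \<open>The Cramer-Rao bound is obtained as the limit of the Hammersley-Chapman-Robbins bound.  Changing
  the location from \<open>x\<close> to \<open>u\<close> shifts the Gaussian data, so an unbiased \<open>T\<close> satisfies
  \<open>E[(T - x) (l\<^sub>u - 1)] = u - x\<close> with the likelihood ratio \<open>l\<^sub>u\<close>, and the second moments of the \<open>l\<^sub>u - 1\<close>
  are explicit.  Choosing \<open>u = x + t e\<^sub>m\<close>, minimising over linear combinations of the \<open>(l\<^sub>u - 1) / t\<close> and
  letting \<open>t\<close> tend to 0 yields the trace of the inverse information matrix.  No differentiation under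
  the integral sign is involved, so the estimator needs no regularity beyond measurability.\<close>

section \<open>Twice differentiable functions and partial derivatives\<close>

text \<open>The gradient \<open>g\<close> is required on a neighbourhood because an iterated partial
  derivative needs the inner one around \<open>x\<close>, whereas the outer one is taken only at
  \<open>x\<close>. In this form the property passes through sums, products and compositions, so the
  received power can be treated term by term.\<close>

definition twice_differentiable_at :: "(real ^ 'm::finite \<Rightarrow> real) \<Rightarrow> real ^ 'm \<Rightarrow> bool" where
  "twice_differentiable_at f x \<longleftrightarrow> (\<exists>g.
     (\<forall>\<^sub>F u in nhds x. (f has_derivative (\<lambda>h. \<Sum>m\<in>UNIV. h $ m * g m u)) (at u)) \<and>
     (\<forall>m. g m differentiable at x))"

lemma twice_differentiable_atI:
  assumes "\<forall>\<^sub>F u in nhds x. (f has_derivative (\<lambda>h. \<Sum>m\<in>UNIV. h $ m * g m u)) (at u)"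
    and "\<And>m. g m differentiable at x"
  shows "twice_differentiable_at f x"
  using assms unfolding twice_differentiable_at_def by blast

lemma twice_differentiable_imp_differentiable:
  assumes "twice_differentiable_at f x"
  shows "f differentiable at x"
proof -
  obtain g where "\<forall>\<^sub>F u in nhds x. (f has_derivative (\<lambda>h. \<Sum>m\<in>UNIV. h $ m * g m u)) (at u)"
    using assms unfolding twice_differentiable_at_def by blast
  from eventually_nhds_x_imp_x[OF this] show ?thesis
    by (auto simp: differentiable_def)
qed

lemma twice_differentiable_imp_eventually_in:
  assumes "twice_differentiable_at f x" "open T" "f x \<in> T"
  shows "\<forall>\<^sub>F u in nhds x. f u \<in> T"
proof -
  have "isCont f x"
    using twice_differentiable_imp_differentiable[OF assms(1)] by (rule differentiable_imp_continuous_within)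
  then have "(f \<longlongrightarrow> f x) (nhds x)"
    by (simp add: isCont_def tendsto_nhds_iff)
  then show ?thesis
    using assms(2,3) by (rule topological_tendstoD)
qed

section \<open>Closure properties of twice differentiability\<close>

lemma twice_differentiable_const: "twice_differentiable_at (\<lambda>u. c) x"
  by (rule twice_differentiable_atI[where g = "\<lambda>_ _. 0"]) auto

lemma twice_differentiable_nth: "twice_differentiable_at (\<lambda>u. u $ k) x"
proof (rule twice_differentiable_atI[where g = "\<lambda>m _. if m = k then 1 else 0"])
  have "(\<lambda>h::real^'a. \<Sum>m\<in>UNIV. h $ m * (if m = k then 1 else 0)) = (\<lambda>h. h $ k)"
    by (simp add: if_distrib cong: if_cong)
  then show "\<forall>\<^sub>F u in nhds x. ((\<lambda>u. u $ k) has_derivative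
      (\<lambda>h. \<Sum>m\<in>UNIV. h $ m * (if m = k then 1 else 0))) (at u)"
    by (simp add: bounded_linear.has_derivative bounded_linear_vec_nth bounded_linear_imp_has_derivative)
qed auto

lemma twice_differentiable_add:
  assumes "twice_differentiable_at f x" "twice_differentiable_at g x"
  shows "twice_differentiable_at (\<lambda>u. f u + g u) x"
proof -
  obtain f' g' where
    f: "\<forall>\<^sub>F u in nhds x. (f has_derivative (\<lambda>h. \<Sum>m\<in>UNIV. h $ m * f' m u)) (at u)"
      "\<And>m. f' m differentiable at x" and
    g: "\<forall>\<^sub>F u in nhds x. (g has_derivative (\<lambda>h. \<Sum>m\<in>UNIV. h $ m * g' m u)) (at u)"
      "\<And>m. g' m differentiable at x"
    using assms unfolding twice_differentiable_at_def by blast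
  show ?thesis
  proof (rule twice_differentiable_atI[where g = "\<lambda>m u. f' m u + g' m u"])
    show "\<forall>\<^sub>F u in nhds x. ((\<lambda>u. f u + g u) has_derivative
        (\<lambda>h. \<Sum>m\<in>UNIV. h $ m * (f' m u + g' m u))) (at u)"
      using f(1) g(1)
    proof eventually_elim
      case (elim u)
      from has_derivative_add[OF this] show ?case
        by (simp add: distrib_left sum.distrib)
    qed
  qed (intro differentiable_add f g)
qed

lemma twice_differentiable_mult:
  assumes "twice_differentiable_at f x" "twice_differentiable_at g x"
  shows "twice_differentiable_at (\<lambda>u. f u * g u) x"
proof -
  obtain f' g' where
    f: "\<forall>\<^sub>F u in nhds x. (f has_derivative (\<lambda>h. \<Sum>m\<in>UNIV. h $ m * f' m u)) (at u)"
      "\<And>m. f' m differentiable at x" and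
    g: "\<forall>\<^sub>F u in nhds x. (g has_derivative (\<lambda>h. \<Sum>m\<in>UNIV. h $ m * g' m u)) (at u)"
      "\<And>m. g' m differentiable at x"
    using assms unfolding twice_differentiable_at_def by blast
  show ?thesis
  proof (rule twice_differentiable_atI[where g = "\<lambda>m u. f u * g' m u + f' m u * g u"])
    show "\<forall>\<^sub>F u in nhds x. ((\<lambda>u. f u * g u) has_derivative
        (\<lambda>h. \<Sum>m\<in>UNIV. h $ m * (f u * g' m u + f' m u * g u))) (at u)"
      using f(1) g(1)
    proof eventually_elim
      case (elim u)
      from has_derivative_mult[OF this] show ?case
        by (simp add: algebra_simps sum.distrib sum_distrib_left)
    qed
  qed (intro differentiable_add differentiable_mult f g
        assms[THEN twice_differentiable_imp_differentiable])
qed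

text \<open>The open set \<open>T\<close> keeps the argument away from the singularities of
  \<open>sqrt\<close>, \<open>inverse\<close> and \<open>ln\<close>: by continuity
  \<open>f u\<close> stays in \<open>T\<close> for \<open>u\<close> near \<open>x\<close>, so the
  chain rule is available on a whole neighbourhood.\<close>

lemma twice_differentiable_compose:
  fixes \<phi> :: "real \<Rightarrow> real"
  assumes f: "twice_differentiable_at f x"
    and T: "open T" "f x \<in> T" "\<And>y. y \<in> T \<Longrightarrow> (\<phi> has_real_derivative \<phi>' y) (at y)"
    and \<phi>': "\<phi>' differentiable at (f x)"
  shows "twice_differentiable_at (\<lambda>u. \<phi> (f u)) x"
proof -
  obtain f' where
    f': "\<forall>\<^sub>F u in nhds x. (f has_derivative (\<lambda>h. \<Sum>m\<in>UNIV. h $ m * f' m u)) (at u)"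
      "\<And>m. f' m differentiable at x"
    using f unfolding twice_differentiable_at_def by blast
  show ?thesis
  proof (rule twice_differentiable_atI[where g = "\<lambda>m u. \<phi>' (f u) * f' m u"])
    show "\<forall>\<^sub>F u in nhds x. ((\<lambda>u. \<phi> (f u)) has_derivative
        (\<lambda>h. \<Sum>m\<in>UNIV. h $ m * (\<phi>' (f u) * f' m u))) (at u)"
      using f'(1) twice_differentiable_imp_eventually_in[OF f T(1,2)]
    proof eventually_elim
      case (elim u)
      have "(\<phi> has_derivative (\<lambda>y. \<phi>' (f u) * y)) (at (f u))"
        using T(3)[OF elim(2)] by (simp add: has_field_derivative_def)
      from has_derivative_compose[OF elim(1) this] show ?case
        by (simp add: sum_distrib_left mult_ac)
    qed
    show "(\<lambda>u. \<phi>' (f u) * f' m u) differentiable at x" for m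
      using differentiable_compose[OF \<phi>' twice_differentiable_imp_differentiable[OF f]] f'(2)
      by (rule differentiable_mult)
  qed
qed

lemma differentiable_at_real:
  "(f has_real_derivative D) (at y) \<Longrightarrow> f differentiable at y"
  by (auto simp: real_differentiable_def)

lemma twice_differentiable_sqrt:
  assumes "twice_differentiable_at f x" "0 < f x"
  shows "twice_differentiable_at (\<lambda>u. sqrt (f u)) x"
  by (rule twice_differentiable_compose[where T = "{0<..}" and \<phi>' = "\<lambda>y. inverse (sqrt y) / 2"])
    (use assms in \<open>auto intro!: derivative_eq_intros differentiable_at_real\<close>)

lemma twice_differentiable_inverse:
  assumes "twice_differentiable_at f x" "f x \<noteq> 0"
  shows "twice_differentiable_at (\<lambda>u. inverse (f u)) x"
  by (rule twice_differentiable_compose[where T = "- {0}" and \<phi>' = "\<lambda>y. - (inverse y ^ 2)"])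
    (use assms in \<open>auto intro!: derivative_eq_intros differentiable_at_real simp: power2_eq_square\<close>)

lemma twice_differentiable_divide:
  assumes "twice_differentiable_at f x" "twice_differentiable_at g x" "g x \<noteq> 0"
  shows "twice_differentiable_at (\<lambda>u. f u / g u) x"
  unfolding divide_inverse
  by (intro twice_differentiable_mult twice_differentiable_inverse assms)

lemma twice_differentiable_ln:
  assumes "twice_differentiable_at f x" "0 < f x"
  shows "twice_differentiable_at (\<lambda>u. ln (f u)) x"
  by (rule twice_differentiable_compose[where T = "{0<..}" and \<phi>' = inverse])
    (use assms in \<open>auto intro!: derivative_eq_intros differentiable_at_real simp: divide_inverse\<close>)

lemma twice_differentiable_sin:
  assumes "twice_differentiable_at f x"
  shows "twice_differentiable_at (\<lambda>u. sin (f u)) x"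
  by (rule twice_differentiable_compose[where T = UNIV and \<phi>' = cos])
    (use assms in \<open>auto intro!: derivative_eq_intros differentiable_at_real\<close>)

lemma twice_differentiable_cos:
  assumes "twice_differentiable_at f x"
  shows "twice_differentiable_at (\<lambda>u. cos (f u)) x"
  by (rule twice_differentiable_compose[where T = UNIV and \<phi>' = "\<lambda>y. - sin y"])
    (use assms in \<open>auto intro!: derivative_eq_intros differentiable_at_real\<close>)

lemma twice_differentiable_diff:
  assumes "twice_differentiable_at f x" "twice_differentiable_at g x"
  shows "twice_differentiable_at (\<lambda>u. f u - g u) x"
  using twice_differentiable_add[OF assms(1) twice_differentiable_mult[OF twice_differentiable_const[of "-1"] assms(2)]]
  by simp

lemma twice_differentiable_power2:
  "twice_differentiable_at f x \<Longrightarrow> twice_differentiable_at (\<lambda>u. (f u)\<^sup>2) x"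
  unfolding power2_eq_square by (rule twice_differentiable_mult)

section \<open>Partial derivatives along the coordinate axes\<close>

lemma has_partial_derivative:
  assumes "f differentiable at u"
  shows "((\<lambda>t. f (u + t *\<^sub>R axis m 1)) has_real_derivative partial m f u) (at 0)"
proof -
  obtain f' where f': "(f has_derivative f') (at (u + 0 *\<^sub>R axis m 1))"
    using assms by (auto simp: differentiable_def)
  have "((\<lambda>t. u + t *\<^sub>R axis m 1) has_derivative (\<lambda>t. t *\<^sub>R axis m 1)) (at 0)"
    by (auto intro!: derivative_eq_intros)
  from has_derivative_compose[OF this f']
  have "(\<lambda>t. f (u + t *\<^sub>R axis m 1)) differentiable at 0"
    by (auto simp: differentiable_def)
  then show ?thesis
    unfolding partial_def by (simp add: DERIV_deriv_iff_real_differentiable)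
qed

lemma partial_eqI:
  "((\<lambda>t. f (u + t *\<^sub>R axis m 1)) has_real_derivative D) (at 0) \<Longrightarrow> partial m f u = D"
  unfolding partial_def by (rule DERIV_imp_deriv)

lemma eventually_along_axis:
  assumes "\<forall>\<^sub>F u in nhds x. P u"
  shows "\<forall>\<^sub>F t in nhds 0. P (x + t *\<^sub>R axis m (1::real))"
proof -
  have "((\<lambda>t. x + t *\<^sub>R axis m 1) \<longlongrightarrow> x + 0 *\<^sub>R axis m (1::real)) (nhds 0)"
    by (intro tendsto_intros filterlim_ident)
  then have "filterlim (\<lambda>t. x + t *\<^sub>R axis m (1::real)) (nhds x) (nhds 0)"
    by simp
  with assms show ?thesis
    by (rule eventually_compose_filterlim)
qed

text \<open>Only the germ of the function at \<open>x\<close> matters. Later this freezes the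
  coverage weights and replaces inner partial derivatives by explicit formulas under an outer
  one.\<close>

lemma partial_cong:
  "\<forall>\<^sub>F u in nhds x. f u = g u \<Longrightarrow> partial m f x = partial m g x"
  unfolding partial_def by (intro deriv_cong_ev eventually_along_axis) auto

text \<open>The gradient witness agrees with the partial derivatives on a neighbourhood of
  \<open>x\<close>, so its differentiability at \<open>x\<close> passes to them. Hence
  \<open>partial m (partial n f) x\<close> is a genuine derivative and not an arbitrary value of
  \<open>deriv\<close>.\<close>

lemma twice_differentiable_partial:
  assumes "twice_differentiable_at f x"
  shows "\<forall>\<^sub>F u in nhds x. f differentiable at u" "partial m f differentiable at x"
proof -
  obtain g where
    f: "\<forall>\<^sub>F u in nhds x. (f has_derivative (\<lambda>h. \<Sum>m\<in>UNIV. h $ m * g m u)) (at u)" and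
    g: "\<And>m. g m differentiable at x"
    using assms unfolding twice_differentiable_at_def by blast
  from f show "\<forall>\<^sub>F u in nhds x. f differentiable at u"
    by eventually_elim (auto simp: differentiable_def)
  have "\<forall>\<^sub>F u in nhds x. g m u = partial m f u"
    using f
  proof eventually_elim
    case (elim u)
    have "((\<lambda>t. u + t *\<^sub>R axis m 1) has_derivative (\<lambda>t. t *\<^sub>R axis m 1)) (at 0)"
      by (auto intro!: derivative_eq_intros)
    from has_derivative_compose[OF this, of f "\<lambda>h. \<Sum>m\<in>UNIV. h $ m * g m u"] elim
    have "((\<lambda>t. f (u + t *\<^sub>R axis m 1)) has_derivative (\<lambda>t. t * g m u)) (at 0)"
      by (simp add: axis_def if_distrib if_distribR cong: if_cong)
    then have "((\<lambda>t. f (u + t *\<^sub>R axis m 1)) has_real_derivative g m u) (at 0)"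
      unfolding has_field_derivative_def mult.commute[of "g m u"] .
    from partial_eqI[OF this] show ?case ..
  qed
  then have "\<forall>\<^sub>F u in at x. g m u = partial m f u" "g m x = partial m f x"
    by (auto simp: eventually_at_filter elim: eventually_mono dest: eventually_nhds_x_imp_x)
  with g[of m] show "partial m f differentiable at x"
    unfolding differentiable_def by (auto intro: has_derivative_transform_eventually)
qed

section \<open>Shifts of Gaussian noise\<close>

text \<open>The density of the normal distribution with mean \<open>d\<close> and covariance \<open>\<sigma>\<^sup>2 I\<close> relative to the centred
  one.\<close>

definition gauss_ratio :: "real \<Rightarrow> ('k::finite \<Rightarrow> real) \<Rightarrow> ('k \<Rightarrow> real) \<Rightarrow> real" where
  "gauss_ratio \<sigma> d y = (\<Prod>k\<in>UNIV. exp ((d k * y k - (d k)\<^sup>2 / 2) / \<sigma>\<^sup>2))"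

lemma gauss_ratio_pos: "0 < gauss_ratio \<sigma> d y"
  by (simp add: gauss_ratio_def prod_pos)

lemma gauss_ratio_measurable [measurable]:
  "gauss_ratio \<sigma> d \<in> borel_measurable (PiM UNIV (\<lambda>_. borel))"
  unfolding gauss_ratio_def by measurable

text \<open>In each exponent \<open>d^2/2 + d'^2/2 = (d + d')^2/2 - d d'\<close>; the cross term is
  free of \<open>y\<close> and comes out as a factor. This makes the mixed second moments of
  likelihood ratios explicit.\<close>

lemma gauss_ratio_mult:
  "gauss_ratio \<sigma> d y * gauss_ratio \<sigma> d' y =
     exp ((\<Sum>k\<in>UNIV. d k * d' k) / \<sigma>\<^sup>2) * gauss_ratio \<sigma> (\<lambda>k. d k + d' k) y"
  unfolding gauss_ratio_def exp_sum[OF finite, symmetric] exp_add[symmetric] sum_divide_distrib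
    sum.distrib[symmetric]
  by (intro arg_cong[where f = exp] sum.cong)
    (auto simp: add_divide_distrib diff_divide_distrib power2_eq_square algebra_simps)

text \<open>Completing the square: \<open>y^2 - 2 d y + d^2 = (y - d)^2\<close>.\<close>

lemma normal_density_shift:
  assumes "0 < \<sigma>"
  shows "normal_density 0 \<sigma> y * exp ((d * y - d\<^sup>2 / 2) / \<sigma>\<^sup>2) = normal_density 0 \<sigma> (y - d)"
  unfolding normal_density_def using assms
  by (auto simp: exp_add[symmetric] power2_eq_square field_simps)

text \<open>Integrated against the density, the exponential weight moves the mean from 0 to
  \<open>d\<close>; translation invariance of Lebesgue measure then moves the shift into the
  event.\<close>

lemma (in prob_space) normal_shift:
  assumes "0 < \<sigma>" and X: "distributed M lborel X (normal_density 0 \<sigma>)" and [measurable]: "A \<in> sets borel"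
  shows "(\<integral>\<^sup>+w. ennreal (exp ((d * X w - d\<^sup>2 / 2) / \<sigma>\<^sup>2)) * indicator A (X w) \<partial>M)
    = emeasure M {w \<in> space M. X w + d \<in> A}"
proof -
  have [measurable]: "X \<in> borel_measurable M"
    using distributed_measurable[OF X] by simp
  have "(\<integral>\<^sup>+w. ennreal (exp ((d * X w - d\<^sup>2 / 2) / \<sigma>\<^sup>2)) * indicator A (X w) \<partial>M)
      = (\<integral>\<^sup>+y. ennreal (normal_density 0 \<sigma> y) * (ennreal (exp ((d * y - d\<^sup>2 / 2) / \<sigma>\<^sup>2)) * indicator A y) \<partial>lborel)"
    by (rule distributed_nn_integral[OF X, symmetric]) measurable
  also have "\<dots> = (\<integral>\<^sup>+y. ennreal (normal_density 0 \<sigma> (y - d)) * indicator A y \<partial>lborel)"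
    unfolding normal_density_shift[OF assms(1), symmetric]
    by (simp add: ennreal_mult' mult_ac)
  also have "\<dots> = (\<integral>\<^sup>+y. ennreal (normal_density 0 \<sigma> y) * indicator A (y + d) \<partial>lborel)"
    by (subst nn_integral_real_affine[where c = 1 and t = d]) (simp_all add: add.commute)
  also have "\<dots> = (\<integral>\<^sup>+w. indicator A (X w + d) \<partial>M)"
    by (rule distributed_nn_integral[OF X]) measurable
  also have "\<dots> = (\<integral>\<^sup>+w. indicator {w \<in> space M. X w + d \<in> A} w \<partial>M)"
    by (intro nn_integral_cong) (simp add: indicator_def)
  finally show ?thesis
    by simp
qed

text \<open>A finite measure on a finite product is determined by its values on boxes. On a box,
  independence factors the probability, \<open>normal_shift\<close> rewrites each factor, and
  independence reassembles the product of expectations into one expectation.\<close>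

lemma (in prob_space) gaussian_shift:
  fixes \<omega> :: "'k::finite \<Rightarrow> 'a \<Rightarrow> real"
  assumes "0 < \<sigma>" and indep: "indep_vars (\<lambda>_. borel) \<omega> UNIV"
    and dist: "\<And>k. distributed M lborel (\<omega> k) (normal_density 0 \<sigma>)"
  shows "distr M (PiM UNIV (\<lambda>_. borel)) (\<lambda>w k. \<omega> k w + d k)
    = density (distr M (PiM UNIV (\<lambda>_. borel)) (\<lambda>w k. \<omega> k w)) (\<lambda>y. ennreal (gauss_ratio \<sigma> d y))"
    (is "?L = ?R")
proof (rule measure_eqI_PiM_finite[where I = UNIV and M = "\<lambda>_. borel"])
  have [measurable]: "\<omega> k \<in> borel_measurable M" for k
    using distributed_measurable[OF dist] by simp
  have [measurable]: "(\<lambda>w k. \<omega> k w) \<in> M \<rightarrow>\<^sub>M PiM UNIV (\<lambda>_. borel)"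
    by (rule measurable_PiM_single') (auto simp: space_PiM)
  have L [measurable]: "(\<lambda>w k. \<omega> k w + d k) \<in> M \<rightarrow>\<^sub>M PiM UNIV (\<lambda>_. borel)"
    by (rule measurable_PiM_single') (auto simp: space_PiM)
  show "emeasure ?L (Pi\<^sub>E UNIV A) = emeasure ?R (Pi\<^sub>E UNIV A)"
    if A: "\<And>k. k \<in> UNIV \<Longrightarrow> A k \<in> sets borel" for A
  proof -
    have [measurable]: "A k \<in> sets borel" for k using A by simp
    have AE [measurable]: "Pi\<^sub>E UNIV A \<in> sets (PiM UNIV (\<lambda>_. borel))"
      by (rule sets_PiM_I_finite) auto
    have indep': "indep_vars (\<lambda>_. borel) (\<lambda>k w. \<omega> k w + d k) UNIV"
      by (rule indep_vars_compose2[OF indep]) auto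
    have "emeasure ?L (Pi\<^sub>E UNIV A) = emeasure M ((\<lambda>w k. \<omega> k w + d k) -` Pi\<^sub>E UNIV A \<inter> space M)"
      by (rule emeasure_distr) measurable
    also have "(\<lambda>w k. \<omega> k w + d k) -` Pi\<^sub>E UNIV A \<inter> space M
        = (\<Inter>k\<in>UNIV. (\<lambda>w. \<omega> k w + d k) -` A k \<inter> space M)"
      by auto
    also have "emeasure M \<dots> = ennreal (\<Prod>k\<in>UNIV. prob ((\<lambda>w. \<omega> k w + d k) -` A k \<inter> space M))"
      unfolding emeasure_eq_measure by (subst indep_varsD_finite[OF indep']) auto
    also have "\<dots> = (\<Prod>k\<in>UNIV. emeasure M {w \<in> space M. \<omega> k w + d k \<in> A k})"
      by (simp add: prod_ennreal emeasure_eq_measure vimage_def Int_def conj_commute)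
    also have "\<dots> = (\<Prod>k\<in>UNIV. \<integral>\<^sup>+w. ennreal (exp ((d k * \<omega> k w - (d k)\<^sup>2 / 2) / \<sigma>\<^sup>2)) * indicator (A k) (\<omega> k w) \<partial>M)"
      by (simp add: normal_shift[OF assms(1) dist])
    also have "\<dots> = (\<integral>\<^sup>+w. (\<Prod>k\<in>UNIV. ennreal (exp ((d k * \<omega> k w - (d k)\<^sup>2 / 2) / \<sigma>\<^sup>2)) * indicator (A k) (\<omega> k w)) \<partial>M)"
      by (rule indep_vars_nn_integral[symmetric])
        (auto intro!: indep_vars_compose2[OF indep, where Y = "\<lambda>k y. ennreal (exp ((d k * y - (d k)\<^sup>2 / 2) / \<sigma>\<^sup>2)) * indicator (A k) y"])
    also have "\<dots> = (\<integral>\<^sup>+w. ennreal (gauss_ratio \<sigma> d (\<lambda>k. \<omega> k w)) * indicator (Pi\<^sub>E UNIV A) (\<lambda>k. \<omega> k w) \<partial>M)"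
    proof (intro nn_integral_cong)
      fix w
      have "(\<Prod>k\<in>UNIV. indicator (A k) (\<omega> k w) :: ennreal) = indicator (Pi\<^sub>E UNIV A) (\<lambda>k. \<omega> k w)"
        by (auto simp: indicator_def PiE_iff)
      then show "(\<Prod>k\<in>UNIV. ennreal (exp ((d k * \<omega> k w - (d k)\<^sup>2 / 2) / \<sigma>\<^sup>2)) * indicator (A k) (\<omega> k w))
          = ennreal (gauss_ratio \<sigma> d (\<lambda>k. \<omega> k w)) * indicator (Pi\<^sub>E UNIV A) (\<lambda>k. \<omega> k w)"
        by (simp add: prod.distrib gauss_ratio_def prod_ennreal)
    qed
    also have "\<dots> = emeasure ?R (Pi\<^sub>E UNIV A)"
      by (simp add: emeasure_density nn_integral_distr)
    finally show ?thesis .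
  qed
  show "range (\<lambda>_. UNIV) \<subseteq> prod_algebra UNIV (\<lambda>_::'k. borel :: real measure)"
    using prod_algebraI_finite[of "UNIV :: 'k set" "\<lambda>_. UNIV" "\<lambda>_. borel :: real measure"]
    by auto
  show "emeasure ?L UNIV \<noteq> \<infinity>"
    using prob_space_distr[OF L] by (simp add: prob_space.finite_measure finite_measure.emeasure_finite)
qed (auto simp: space_PiM)

section \<open>Inverse matrices and a limit of exponentials\<close>

lemma matrix_inv_left_inverse:
  fixes A :: "'a::semiring_1 ^ 'n ^ 'm"
  assumes "invertible A"
  shows "matrix_inv A ** A = mat 1"
  using someI_ex[OF assms[unfolded invertible_def]] by (simp add: matrix_inv_def)

text \<open>The hypothesis forces \<open>q t\<close> to tend to 0, where \<open>exp z - 1\<close>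
  behaves like \<open>z\<close>. Second moments of difference quotients of likelihood ratios have
  this shape; the limit turns them into entries of the information matrix.\<close>

lemma exp_minus_one_over_square_tendsto:
  fixes q :: "real \<Rightarrow> real"
  assumes "((\<lambda>t. q t / t\<^sup>2) \<longlongrightarrow> L) (at 0)"
  shows "((\<lambda>t. (exp (q t) - 1) / t\<^sup>2) \<longlongrightarrow> L) (at 0)"
proof -
  \<comment> \<open>Caratheodory's slope function stands for \<open>(exp z - 1) / z\<close> and
    remains meaningful at those \<open>t\<close> where \<open>q t = 0\<close>.\<close>
  obtain \<phi> :: "real \<Rightarrow> real" where \<phi>: "\<And>z. exp z - exp 0 = \<phi> z * (z - 0)" "isCont \<phi> 0" "\<phi> 0 = exp 0"
    using DERIV_exp[of "0::real"] unfolding CARAT_DERIV by blast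
  have "((\<lambda>t. q t / t\<^sup>2 * t\<^sup>2) \<longlongrightarrow> L * 0\<^sup>2) (at 0)"
    by (intro tendsto_intros assms)
  then have "((\<lambda>t. q t / t\<^sup>2 * t\<^sup>2) \<longlongrightarrow> 0) (at 0)"
    by simp
  moreover have "\<forall>\<^sub>F t in at 0. q t / t\<^sup>2 * t\<^sup>2 = q t"
    by (auto simp: eventually_at_filter)
  ultimately have q: "(q \<longlongrightarrow> 0) (at 0)"
    by (rule Lim_transform_eventually)
  have "((\<lambda>t. \<phi> (q t) * (q t / t\<^sup>2)) \<longlongrightarrow> \<phi> 0 * L) (at 0)"
    by (intro tendsto_intros assms isCont_tendsto_compose[OF \<phi>(2) q])
  then show ?thesis
    using \<phi>(1,3) by simp
qed

section \<open>Moments of Gaussian likelihood ratios and the resulting bound\<close>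

context prob_space
begin

lemma has_integral_const: "has_bochner_integral M (\<lambda>_. c) c"
  for c :: "'b::{banach, second_countable_topology}"
  by (simp add: has_bochner_integral_iff prob_space)

context
  fixes \<omega> :: "'k::finite \<Rightarrow> 'a \<Rightarrow> real" and \<sigma> :: real
  assumes \<sigma>: "0 < \<sigma>" and indep: "indep_vars (\<lambda>_. borel) \<omega> UNIV"
    and dist: "\<And>k. distributed M lborel (\<omega> k) (normal_density 0 \<sigma>)"
begin

lemma noise_measurable [measurable]: "\<omega> k \<in> borel_measurable M"
  using distributed_measurable[OF dist] by simp

lemma noise_shift_measurable [measurable]:
  "(\<lambda>w k. \<omega> k w + d k) \<in> M \<rightarrow>\<^sub>M PiM UNIV (\<lambda>_. borel)"
  by (rule measurable_PiM_single') (auto simp: space_PiM)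

lemma noise_vec_measurable [measurable]: "(\<lambda>w k. \<omega> k w) \<in> M \<rightarrow>\<^sub>M PiM UNIV (\<lambda>_. borel)"
  by (rule measurable_PiM_single') (auto simp: space_PiM)

text \<open>This is the change of measure of \<open>gaussian_shift\<close>. Integrability is
  transported separately from the value, since a non-integrable function has Bochner integral 0 and
  an equation between integrals would not carry unbiasedness over.\<close>

lemma integrable_gaussian_shift:
  fixes f :: "('k \<Rightarrow> real) \<Rightarrow> 'b::{banach, second_countable_topology}"
  assumes [measurable]: "f \<in> borel_measurable (PiM UNIV (\<lambda>_. borel))"
  shows "integrable M (\<lambda>w. f (\<lambda>k. \<omega> k w + d k)) \<longleftrightarrow>
    integrable M (\<lambda>w. gauss_ratio \<sigma> d (\<lambda>k. \<omega> k w) *\<^sub>R f (\<lambda>k. \<omega> k w))"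
proof -
  have "integrable M (\<lambda>w. f (\<lambda>k. \<omega> k w + d k)) \<longleftrightarrow>
      integrable (distr M (PiM UNIV (\<lambda>_. borel)) (\<lambda>w k. \<omega> k w + d k)) f"
    by (rule integrable_distr_eq[symmetric]) measurable
  also have "\<dots> \<longleftrightarrow> integrable (distr M (PiM UNIV (\<lambda>_. borel)) (\<lambda>w k. \<omega> k w)) (\<lambda>y. gauss_ratio \<sigma> d y *\<^sub>R f y)"
    unfolding gaussian_shift[OF \<sigma> indep dist]
    by (rule integrable_density) (auto simp: less_imp_le gauss_ratio_pos)
  also have "\<dots> \<longleftrightarrow> integrable M (\<lambda>w. gauss_ratio \<sigma> d (\<lambda>k. \<omega> k w) *\<^sub>R f (\<lambda>k. \<omega> k w))"
    by (rule integrable_distr_eq) measurable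
  finally show ?thesis .
qed

lemma integral_gaussian_shift:
  fixes f :: "('k \<Rightarrow> real) \<Rightarrow> 'b::{banach, second_countable_topology}"
  assumes [measurable]: "f \<in> borel_measurable (PiM UNIV (\<lambda>_. borel))"
  shows "(\<integral>w. f (\<lambda>k. \<omega> k w + d k) \<partial>M) =
    (\<integral>w. gauss_ratio \<sigma> d (\<lambda>k. \<omega> k w) *\<^sub>R f (\<lambda>k. \<omega> k w) \<partial>M)"
proof -
  have "(\<integral>w. f (\<lambda>k. \<omega> k w + d k) \<partial>M) =
      integral\<^sup>L (distr M (PiM UNIV (\<lambda>_. borel)) (\<lambda>w k. \<omega> k w + d k)) f"
    by (rule integral_distr[symmetric]) measurable
  also have "\<dots> = (\<integral>y. gauss_ratio \<sigma> d y *\<^sub>R f y \<partial>distr M (PiM UNIV (\<lambda>_. borel)) (\<lambda>w k. \<omega> k w))"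
    unfolding gaussian_shift[OF \<sigma> indep dist]
    by (rule integral_density) (auto simp: less_imp_le gauss_ratio_pos)
  also have "\<dots> = (\<integral>w. gauss_ratio \<sigma> d (\<lambda>k. \<omega> k w) *\<^sub>R f (\<lambda>k. \<omega> k w) \<partial>M)"
    by (rule integral_distr) measurable
  finally show ?thesis .
qed

lemma has_integral_gauss_ratio:
  "has_bochner_integral M (\<lambda>w. gauss_ratio \<sigma> d (\<lambda>k. \<omega> k w)) 1"
  using integrable_gaussian_shift[of "\<lambda>_. 1 :: real" d] integral_gaussian_shift[of "\<lambda>_. 1 :: real" d]
  by (simp add: has_bochner_integral_iff prob_space)

text \<open>By \<open>gauss_ratio_mult\<close> the product is a constant times the ratio for the
  shift \<open>d + d'\<close>, which has mean 1.\<close>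

lemma has_integral_gauss_ratio_mult:
  "has_bochner_integral M (\<lambda>w. gauss_ratio \<sigma> d (\<lambda>k. \<omega> k w) * gauss_ratio \<sigma> d' (\<lambda>k. \<omega> k w))
     (exp ((\<Sum>k\<in>UNIV. d k * d' k) / \<sigma>\<^sup>2))"
  unfolding gauss_ratio_mult
  using has_bochner_integral_mult_right[OF has_integral_gauss_ratio] by simp

text \<open>Here \<open>T\<close> is the estimator as a function of the noise, \<open>D u\<close>
  the shift of the noise equivalent to moving the parameter from \<open>x\<close> to
  \<open>u\<close>, and \<open>J\<close> the Jacobian of that shift at \<open>x\<close>. With values
  in \<open>ennreal\<close> the bound includes the case of an infinite mean square error.\<close>

theorem gaussian_cramer_rao:
  fixes T :: "('k \<Rightarrow> real) \<Rightarrow> real ^ 'm::finite" and D :: "real ^ 'm \<Rightarrow> 'k \<Rightarrow> real"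
    and F :: "real ^ 'm ^ 'm"
  assumes T [measurable]: "T \<in> borel_measurable (PiM UNIV (\<lambda>_. borel))"
    and S: "open S" "x \<in> S"
    and unbiased: "\<And>u. u \<in> S \<Longrightarrow> has_bochner_integral M (\<lambda>w. T (\<lambda>k. \<omega> k w + D u k)) u"
    and Dx: "\<And>k. D x k = 0"
    and deriv: "\<And>k m. ((\<lambda>t. D (x + t *\<^sub>R axis m 1) k) has_real_derivative J k m) (at 0)"
    and F: "\<And>m n. F $ m $ n = 1 / \<sigma>\<^sup>2 * (\<Sum>k\<in>UNIV. J k m * J k n)"
    and inv: "invertible F"
  shows "ennreal (\<Sum>m\<in>UNIV. matrix_inv F $ m $ m) \<le> (\<integral>\<^sup>+w. ennreal ((norm (T (\<lambda>k. \<omega> k w) - x))\<^sup>2) \<partial>M)"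
proof (cases "(\<integral>\<^sup>+w. ennreal ((norm (T (\<lambda>k. \<omega> k w) - x))\<^sup>2) \<partial>M) = \<infinity>")
  case True
  then show ?thesis by simp
next
  case False
  define Z where "Z w = T (\<lambda>k. \<omega> k w)" for w
  have [measurable]: "Z \<in> borel_measurable M"
    unfolding Z_def by measurable
  \<comment> \<open>The inverse information is the coefficient matrix that minimises the limit
    \<open>V - 2 tr B + tr (B F B^T)\<close> of the mean square residual.\<close>
  define B where "B = matrix_inv F"
  define V where "V = (\<integral>w. (norm (Z w - x))\<^sup>2 \<partial>M)"
  have sq: "integrable M (\<lambda>w. (norm (Z w - x))\<^sup>2)"
    using False by (intro integrableI_bounded) (auto simp: Z_def top.not_eq_extremum)
  have "(\<integral>\<^sup>+w. ennreal ((norm (T (\<lambda>k. \<omega> k w) - x))\<^sup>2) \<partial>M) = ennreal V"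
    using nn_integral_eq_integral[OF sq] by (simp add: V_def Z_def)
  moreover have "(\<Sum>m\<in>UNIV. B $ m $ m) \<le> V"
  proof -
    have normsq: "(norm v)\<^sup>2 = (\<Sum>a\<in>UNIV. (v $ a)\<^sup>2)" for v :: "real ^ 'm"
      unfolding power2_norm_eq_inner inner_vec_def by (simp add: power2_eq_square)
    \<comment> \<open>\<open>X\<close> is the error, \<open>l\<close> the likelihood ratio for a
      move by \<open>t\<close> along an axis, \<open>r\<close> its difference quotient in the role
      of the score, \<open>G\<close> the second moments of \<open>r\<close>, and \<open>Q t\<close>
      will be the value of \<open>E |X - B r|^2\<close>.\<close>
    define X where "X a w = (Z w - x) $ a" for a w
    define l where "l t b w = gauss_ratio \<sigma> (D (x + t *\<^sub>R axis b 1)) (\<lambda>k. \<omega> k w)" for t b w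
    define r where "r t b w = (l t b w - 1) / t" for t b w
    define G where "G t b c = (exp ((\<Sum>k\<in>UNIV. D (x + t *\<^sub>R axis b 1) k * D (x + t *\<^sub>R axis c 1) k) / \<sigma>\<^sup>2) - 1) / t\<^sup>2" for t b c
    define Q where "Q t = V - 2 * (\<Sum>a\<in>UNIV. B $ a $ a)
        + (\<Sum>a\<in>UNIV. \<Sum>b\<in>UNIV. \<Sum>c\<in>UNIV. B $ a $ b * B $ a $ c * G t b c)" for t
    have Zx: "has_bochner_integral M Z x"
      using unbiased[OF S(2)] by (simp add: Dx Z_def[abs_def])
    \<comment> \<open>\<open>E[(l_b - 1) (l_c - 1)] = E[l_b l_c] - 1\<close>, since both ratios have
      mean 1.\<close>
    have r2: "has_bochner_integral M (\<lambda>w. r t b w * r t c w) (G t b c)" if "t \<noteq> 0" for t b c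
    proof -
      have "has_bochner_integral M (\<lambda>w. (l t b w * l t c w - l t b w - l t c w + 1) / t\<^sup>2)
          ((exp ((\<Sum>k\<in>UNIV. D (x + t *\<^sub>R axis b 1) k * D (x + t *\<^sub>R axis c 1) k) / \<sigma>\<^sup>2)
             - 1 - 1 + 1) / t\<^sup>2)"
        unfolding l_def
        by (intro has_bochner_integral_divide_zero has_bochner_integral_add has_bochner_integral_diff
            has_integral_gauss_ratio has_integral_gauss_ratio_mult has_integral_const)
      moreover have "(l t b w * l t c w - l t b w - l t c w + 1) / t\<^sup>2 = r t b w * r t c w" for w
        by (simp add: r_def power2_eq_square algebra_simps add_divide_distrib diff_divide_distrib)
      ultimately show ?thesis by (simp add: G_def)
    qed
    \<comment> \<open>Unbiasedness at the displaced location enters here: weighting \<open>Z\<close>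
      by \<open>l\<close> gives mean \<open>x + t e_b\<close>. Expanding
      \<open>(l - 1) (Z - x)\<close> into terms of known mean leaves \<open>t e_b\<close>, and
      division by \<open>t\<close> gives the Kronecker delta.\<close>
    have Xr: "has_bochner_integral M (\<lambda>w. X a w * r t b w) (if a = b then 1 else 0)"
      if "t \<noteq> 0" "x + t *\<^sub>R axis b 1 \<in> S" for t a b
    proof -
      have "has_bochner_integral M (\<lambda>w. l t b w *\<^sub>R Z w) (x + t *\<^sub>R axis b 1)"
        using unbiased[OF that(2)]
        unfolding has_bochner_integral_iff integrable_gaussian_shift[OF T]
          integral_gaussian_shift[OF T] l_def Z_def .
      then have "has_bochner_integral M (\<lambda>w. l t b w *\<^sub>R Z w - l t b w *\<^sub>R x - Z w + x)
          (x + t *\<^sub>R axis b 1 - 1 *\<^sub>R x - x + x)"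
        unfolding l_def by (intro has_bochner_integral_add has_bochner_integral_diff
            has_bochner_integral_scaleR_left has_integral_gauss_ratio has_integral_const Zx)
      then have "has_bochner_integral M (\<lambda>w. ((l t b w - 1) *\<^sub>R (Z w - x)) $ a) ((t *\<^sub>R axis b 1) $ a)"
        by (intro has_bochner_integral_bounded_linear[OF bounded_linear_vec_nth])
          (simp add: algebra_simps)
      then have "has_bochner_integral M (\<lambda>w. ((l t b w - 1) *\<^sub>R (Z w - x)) $ a / t) ((t *\<^sub>R axis b 1) $ a / t)"
        by (rule has_bochner_integral_divide_zero)
      then show ?thesis
        using that by (simp add: X_def r_def axis_def mult.commute split: if_splits)
    qed
    have "0 \<le> Q t" if t: "t \<noteq> 0" "\<forall>b. x + t *\<^sub>R axis b 1 \<in> S" for t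
    proof -
      \<comment> \<open>The integrand is the expanded square of \<open>X - B r\<close>, with mean
        read off from \<open>Xr\<close> and \<open>r2\<close>; regrouping it as a sum of squares
        shows that the mean is nonnegative.\<close>
      have "has_bochner_integral M (\<lambda>w. (norm (Z w - x))\<^sup>2 - 2 * (\<Sum>a\<in>UNIV. \<Sum>b\<in>UNIV. B $ a $ b * (X a w * r t b w))
          + (\<Sum>a\<in>UNIV. \<Sum>b\<in>UNIV. \<Sum>c\<in>UNIV. B $ a $ b * B $ a $ c * (r t b w * r t c w)))
          (V - 2 * (\<Sum>a\<in>UNIV. \<Sum>b\<in>UNIV. B $ a $ b * (if a = b then 1 else 0))
          + (\<Sum>a\<in>UNIV. \<Sum>b\<in>UNIV. \<Sum>c\<in>UNIV. B $ a $ b * B $ a $ c * G t b c))"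
        using sq t by (intro has_bochner_integral_add has_bochner_integral_diff
            has_bochner_integral_mult_right has_bochner_integral_sum Xr r2)
          (auto simp: V_def has_bochner_integral_iff)
      moreover have "(norm (Z w - x))\<^sup>2 - 2 * (\<Sum>a\<in>UNIV. \<Sum>b\<in>UNIV. B $ a $ b * (X a w * r t b w))
          + (\<Sum>a\<in>UNIV. \<Sum>b\<in>UNIV. \<Sum>c\<in>UNIV. B $ a $ b * B $ a $ c * (r t b w * r t c w))
          = (\<Sum>a\<in>UNIV. (X a w - (\<Sum>b\<in>UNIV. B $ a $ b * r t b w))\<^sup>2)" for w
      proof -
        have "(X a w - (\<Sum>b\<in>UNIV. B $ a $ b * r t b w))\<^sup>2 = (X a w)\<^sup>2 - 2 * (\<Sum>b\<in>UNIV. B $ a $ b * (X a w * r t b w))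
            + (\<Sum>b\<in>UNIV. \<Sum>c\<in>UNIV. B $ a $ b * B $ a $ c * (r t b w * r t c w))" for a
          unfolding power2_diff
          by (simp add: power2_eq_square sum_product sum_distrib_left mult_ac)
        then show ?thesis
          by (simp add: normsq X_def sum.distrib sum_subtractf sum_distrib_left)
      qed
      ultimately have "has_bochner_integral M (\<lambda>w. \<Sum>a\<in>UNIV. (X a w - (\<Sum>b\<in>UNIV. B $ a $ b * r t b w))\<^sup>2) (Q t)"
        by (simp add: Q_def if_distrib cong: if_cong)
      from has_bochner_integral_integral_eq[OF this, symmetric] show ?thesis
        by (auto intro!: Bochner_Integration.integral_nonneg sum_nonneg)
    qed
    \<comment> \<open>As \<open>S\<close> is open and there are finitely many axes, all displaced
      locations lie in \<open>S\<close> for small \<open>t\<close>.\<close>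
    moreover have "\<forall>\<^sub>F t in at 0. t \<noteq> 0 \<and> (\<forall>b. x + t *\<^sub>R axis b 1 \<in> S)"
    proof (intro eventually_conj)
      have "\<forall>\<^sub>F t in at 0. x + t *\<^sub>R axis b 1 \<in> S" for b
      proof (rule topological_tendstoD[OF _ S(1)])
        show "((\<lambda>t. x + t *\<^sub>R axis b 1) \<longlongrightarrow> x + 0 *\<^sub>R axis b 1) (at 0)"
          by (intro tendsto_intros)
      qed (use S in simp)
      then show "\<forall>\<^sub>F t in at 0. \<forall>b. x + t *\<^sub>R axis b 1 \<in> S"
        by (rule eventually_all_finite)
    qed (simp add: eventually_at_filter)
    ultimately have ev: "\<forall>\<^sub>F t in at 0. 0 \<le> Q t"
      by (auto elim: eventually_mono)
    \<comment> \<open>Since \<open>D\<close> vanishes at \<open>x\<close>, the quotients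
      \<open>D (x + t e_b) / t\<close> tend to the columns of \<open>J\<close>, so the exponent
      divided by \<open>t^2\<close> tends to \<open>F\<close>.\<close>
    have GF: "((\<lambda>t. G t b c) \<longlongrightarrow> F $ b $ c) (at 0)" for b c
      unfolding G_def
    proof (rule exp_minus_one_over_square_tendsto)
      have "((\<lambda>t. D (x + t *\<^sub>R axis m 1) k / t) \<longlongrightarrow> J k m) (at 0)" for k m
        using deriv[of m k] by (simp add: DERIV_def Dx)
      then have "((\<lambda>t. 1 / \<sigma>\<^sup>2 * (\<Sum>k\<in>UNIV. D (x + t *\<^sub>R axis b 1) k / t * (D (x + t *\<^sub>R axis c 1) k / t)))
          \<longlongrightarrow> F $ b $ c) (at 0)"
        unfolding F by (intro tendsto_intros)
      then show "((\<lambda>t. (\<Sum>k\<in>UNIV. D (x + t *\<^sub>R axis b 1) k * D (x + t *\<^sub>R axis c 1) k) / \<sigma>\<^sup>2 / t\<^sup>2)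
          \<longlongrightarrow> F $ b $ c) (at 0)"
        by (simp add: sum_divide_distrib sum_distrib_left power2_eq_square)
    qed
    have "(Q \<longlongrightarrow> V - 2 * (\<Sum>a\<in>UNIV. B $ a $ a)
        + (\<Sum>a\<in>UNIV. \<Sum>b\<in>UNIV. \<Sum>c\<in>UNIV. B $ a $ b * B $ a $ c * F $ b $ c)) (at 0)"
      unfolding Q_def by (intro tendsto_intros GF)
    \<comment> \<open>This is \<open>tr (B F B^T) = tr B\<close>, from \<open>B F = 1\<close>; it
      cancels one of the two copies of \<open>tr B\<close> in the limit of \<open>Q\<close>.\<close>
    moreover have "(\<Sum>a\<in>UNIV. \<Sum>b\<in>UNIV. \<Sum>c\<in>UNIV. B $ a $ b * B $ a $ c * F $ b $ c) = (\<Sum>a\<in>UNIV. B $ a $ a)"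
    proof (rule sum.cong[OF refl])
      fix a :: 'm
      have BF: "(\<Sum>b\<in>UNIV. B $ a $ b * F $ b $ c) = (if a = c then 1 else 0)" for c
        using arg_cong[OF matrix_inv_left_inverse[OF inv], of "\<lambda>A. A $ a $ c"]
        by (simp add: B_def matrix_matrix_mult_def mat_def)
      have "(\<Sum>b\<in>UNIV. \<Sum>c\<in>UNIV. B $ a $ b * B $ a $ c * F $ b $ c)
          = (\<Sum>c\<in>UNIV. B $ a $ c * (\<Sum>b\<in>UNIV. B $ a $ b * F $ b $ c))"
        by (subst sum.swap) (simp add: sum_distrib_left mult_ac)
      also have "\<dots> = B $ a $ a"
        unfolding BF by (simp add: if_distrib cong: if_cong)
      finally show "(\<Sum>b\<in>UNIV. \<Sum>c\<in>UNIV. B $ a $ b * B $ a $ c * F $ b $ c) = B $ a $ a" .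
    qed
    ultimately have "0 \<le> V - 2 * (\<Sum>a\<in>UNIV. B $ a $ a) + (\<Sum>a\<in>UNIV. B $ a $ a)"
      by (intro tendsto_lowerbound[OF _ ev]) auto
    then show ?thesis by simp
  qed
  ultimately show ?thesis
    by (simp add: B_def ennreal_leI)
qed

end

end

section \<open>Received powers and likelihood\<close>

context
  fixes R :: "'n::finite rfid" and x :: "real ^ 2"
  assumes adm: "admissible R" and reg: "regular_at R x"
begin

lemma sq_ldist_pos: "0 < (x $ 1 - apos R i $ 1)\<^sup>2 + (x $ 2 - apos R i $ 2)\<^sup>2"
proof -
  have "ldist R i x \<noteq> 0"
    using reg by (simp add: regular_at_def)
  then have "(x $ 1 - apos R i $ 1)\<^sup>2 + (x $ 2 - apos R i $ 2)\<^sup>2 \<noteq> 0"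
    by (auto simp: ldist_def)
  then show ?thesis
    by (simp add: order_less_le)
qed

lemma ddist_pos: "0 < ddist R i x"
  unfolding ddist_def real_sqrt_gt_0_iff by (intro add_pos_nonneg sq_ldist_pos) simp

lemma twice_differentiable_ldist: "twice_differentiable_at (ldist R i) x"
  unfolding ldist_def using sq_ldist_pos[of i]
  by (intro twice_differentiable_sqrt twice_differentiable_add twice_differentiable_power2
      twice_differentiable_diff twice_differentiable_nth twice_differentiable_const)

lemma twice_differentiable_ddist: "twice_differentiable_at (ddist R i) x"
  unfolding ddist_def using ddist_pos[of i, unfolded ddist_def real_sqrt_gt_0_iff]
  by (intro twice_differentiable_sqrt twice_differentiable_add twice_differentiable_power2
      twice_differentiable_diff twice_differentiable_nth twice_differentiable_const)

lemma twice_differentiable_gain: "twice_differentiable_at (gainR R i) x"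
proof -
  have gain: "gainR R i x \<noteq> 0" and l: "ldist R i x \<noteq> 0"
    using reg by (auto simp: regular_at_def)
  have d: "ddist R i x \<noteq> 0"
    using ddist_pos[of i] by simp
  \<comment> \<open>Division by zero yields 0, so a vanishing denominator would make the whole gain
    0, against regularity.\<close>
  have "1 - (apos R i $ 3 - tag_z R) / ddist R i x * tan (elev R i) \<noteq> 0"
  proof
    assume "1 - (apos R i $ 3 - tag_z R) / ddist R i x * tan (elev R i) = 0"
    then have "gainR R i x = 0"
      unfolding gainR_def Let_def by simp
    with gain show False ..
  qed
  with l d show ?thesis
    unfolding gainR_def Let_def
    by (intro twice_differentiable_mult twice_differentiable_power2 twice_differentiable_sin
        twice_differentiable_cos twice_differentiable_divide twice_differentiable_diff
        twice_differentiable_add twice_differentiable_const twice_differentiable_nth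
        twice_differentiable_ldist twice_differentiable_ddist)
qed

lemma gain_pos: "0 < gainR R i x"
proof -
  have "0 \<le> gainR R i x"
    by (simp add: gainR_def Let_def)
  moreover have "gainR R i x \<noteq> 0"
    using reg by (simp add: regular_at_def)
  ultimately show ?thesis by simp
qed

lemma path_loss_pos: "0 < path_loss R (ddist R i x)"
  using adm ddist_pos[of i] by (auto simp: path_loss_def admissible_def)

lemma twice_differentiable_path_loss: "twice_differentiable_at (\<lambda>u. path_loss R (ddist R i u)) x"
  unfolding path_loss_def using ddist_pos[of i]
  by (intro twice_differentiable_power2 twice_differentiable_divide twice_differentiable_mult
        twice_differentiable_const twice_differentiable_ddist) simp

lemma twice_differentiable_rx_power: "twice_differentiable_at (rx_power R i j) x"
  unfolding rx_power_def log_def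
  by (intro twice_differentiable_add twice_differentiable_mult twice_differentiable_divide
      twice_differentiable_const twice_differentiable_ln twice_differentiable_gain
      twice_differentiable_path_loss gain_pos path_loss_pos) simp_all

section \<open>Derivatives of powers in decibels\<close>

lemma has_derivative_dB:
  assumes "f differentiable at x" "0 < f x"
  shows "((\<lambda>t. 20 * log 10 (f (x + t *\<^sub>R axis m 1))) has_real_derivative
    20 / ln 10 * (partial m f x / f x)) (at 0)"
  using has_partial_derivative[OF assms(1), of m] assms(2) unfolding log_def
  by (auto intro!: derivative_eq_intros simp: field_simps)

lemma partial_gain_dB:
  "partial m (\<lambda>u. 20 * log 10 (gainR R i u)) x = 20 / ln 10 * (partial m (gainR R i) x / gainR R i x)"
  by (intro partial_eqI has_derivative_dB gain_pos twice_differentiable_imp_differentiable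
      twice_differentiable_gain)

lemma partial_path_loss_dB:
  "partial m (\<lambda>u. 20 * log 10 (path_loss R (ddist R i u))) x =
    20 / ln 10 * (partial m (\<lambda>u. path_loss R (ddist R i u)) x / path_loss R (ddist R i x))"
  by (intro partial_eqI has_derivative_dB[where f = "\<lambda>u. path_loss R (ddist R i u)"] path_loss_pos
      twice_differentiable_imp_differentiable twice_differentiable_path_loss)

text \<open>The derivative of a logarithm is the derivative of its argument relative to its value,
  hence the quotients; the link constant contributes 0.\<close>

lemma partial_rx_power:
  "partial m (rx_power R i j) x = 20 / ln 10 *
     (partial m (gainR R i) x / gainR R i x + partial m (gainR R j) x / gainR R j x
    + partial m (\<lambda>u. path_loss R (ddist R i u)) x / path_loss R (ddist R i x)
    + partial m (\<lambda>u. path_loss R (ddist R j u)) x / path_loss R (ddist R j x))"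
proof (rule partial_eqI)
  note G = has_derivative_dB[OF twice_differentiable_imp_differentiable[OF twice_differentiable_gain] gain_pos]
  note L = has_derivative_dB[OF twice_differentiable_imp_differentiable[OF twice_differentiable_path_loss] path_loss_pos]
  show "((\<lambda>t. rx_power R i j (x + t *\<^sub>R axis m 1)) has_real_derivative 20 / ln 10 *
     (partial m (gainR R i) x / gainR R i x + partial m (gainR R j) x / gainR R j x
    + partial m (\<lambda>u. path_loss R (ddist R i u)) x / path_loss R (ddist R i x)
    + partial m (\<lambda>u. path_loss R (ddist R j u)) x / path_loss R (ddist R j x))) (at 0)"
    unfolding rx_power_def distrib_left
    by (rule DERIV_cong, (rule DERIV_add DERIV_const G L)+) simp
qed

text \<open>Where the coverage is locally constant, the log-likelihood is up to a constant a least
  squares sum with fixed weights. Its second derivative has a product of first derivatives and a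
  curvature term multiplied by the residual.\<close>

lemma second_partial_log_likelihood:
  assumes \<sigma>: "0 < \<sigma>"
    and cov: "\<And>i j. \<forall>\<^sub>F u in nhds x. coverage R i j u = coverage R i j x"
  shows "partial m (partial n (\<lambda>u. ln (likelihood R \<sigma> p u))) x = - (1 / \<sigma>\<^sup>2) *
    (\<Sum>i\<in>UNIV. \<Sum>j\<in>UNIV. coverage R i j x *
      (partial m (rx_power R i j) x * partial n (rx_power R i j) x
       + (rx_power R i j x - p $ (i, j)) * partial m (partial n (rx_power R i j)) x))"
proof -
  note P = twice_differentiable_partial[OF twice_differentiable_rx_power]
  have ln_lik: "ln (likelihood R \<sigma> p u) = ln (1 / (2 * pi * \<sigma>\<^sup>2) powr (real (CARD('n)\<^sup>2) / 2))
      + - (1 / (2 * \<sigma>\<^sup>2)) * (\<Sum>i\<in>UNIV. \<Sum>j\<in>UNIV. coverage R i j u * (rx_power R i j u - p $ (i, j))\<^sup>2)" for u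
    unfolding likelihood_def using \<sigma> by (subst ln_mult) simp_all
  have cov': "\<forall>\<^sub>F u in nhds x. \<forall>i j. coverage R i j u = coverage R i j x"
    by (intro eventually_all_finite cov)
  have diff: "\<forall>\<^sub>F u in nhds x. \<forall>i j. rx_power R i j differentiable at u"
    by (intro eventually_all_finite P)
  \<comment> \<open>The inner derivative at \<open>u\<close> depends on a neighbourhood of
    \<open>u\<close>, so constancy of the coverage is needed near every \<open>u\<close> near
    \<open>x\<close>; this is what \<open>eventually_eventually\<close> supplies.\<close>
  have "\<forall>\<^sub>F u in nhds x. partial n (\<lambda>u. ln (likelihood R \<sigma> p u)) u = - (1 / \<sigma>\<^sup>2) *
      (\<Sum>i\<in>UNIV. \<Sum>j\<in>UNIV. coverage R i j x * ((rx_power R i j u - p $ (i, j)) * partial n (rx_power R i j) u))"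
    using diff iffD2[OF eventually_eventually cov']
  proof eventually_elim
    case (elim u)
    have "partial n (\<lambda>u. ln (likelihood R \<sigma> p u)) u
        = partial n (\<lambda>u. ln (1 / (2 * pi * \<sigma>\<^sup>2) powr (real (CARD('n)\<^sup>2) / 2))
          + - (1 / (2 * \<sigma>\<^sup>2)) * (\<Sum>i\<in>UNIV. \<Sum>j\<in>UNIV. coverage R i j x * (rx_power R i j u - p $ (i, j))\<^sup>2)) u"
      unfolding ln_lik by (rule partial_cong, rule eventually_mono[OF elim(2)]) simp
    also have "\<dots> = - (1 / \<sigma>\<^sup>2) *
      (\<Sum>i\<in>UNIV. \<Sum>j\<in>UNIV. coverage R i j x * ((rx_power R i j u - p $ (i, j)) * partial n (rx_power R i j) u))"
    proof (rule partial_eqI)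
      have sq: "((\<lambda>t. coverage R i j x * (rx_power R i j (u + t *\<^sub>R axis n 1) - p $ (i, j))\<^sup>2) has_real_derivative
          2 * (coverage R i j x * ((rx_power R i j u - p $ (i, j)) * partial n (rx_power R i j) u))) (at 0)" for i j
        using has_partial_derivative[of "rx_power R i j" u n] elim(1)
        by (auto intro!: derivative_eq_intros)
      show "((\<lambda>t. ln (1 / (2 * pi * \<sigma>\<^sup>2) powr (real (CARD('n)\<^sup>2) / 2)) + - (1 / (2 * \<sigma>\<^sup>2)) *
            (\<Sum>i\<in>UNIV. \<Sum>j\<in>UNIV. coverage R i j x * (rx_power R i j (u + t *\<^sub>R axis n 1) - p $ (i, j))\<^sup>2))
          has_real_derivative - (1 / \<sigma>\<^sup>2) * (\<Sum>i\<in>UNIV. \<Sum>j\<in>UNIV. coverage R i j x *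
            ((rx_power R i j u - p $ (i, j)) * partial n (rx_power R i j) u))) (at 0)"
        by (rule DERIV_cong, (rule DERIV_add DERIV_const DERIV_cmult DERIV_sum sq)+)
          (simp add: sum_distrib_left[symmetric])
    qed
    finally show ?case .
  qed
  from partial_cong[OF this] have "partial m (partial n (\<lambda>u. ln (likelihood R \<sigma> p u))) x
      = partial m (\<lambda>u. - (1 / \<sigma>\<^sup>2) * (\<Sum>i\<in>UNIV. \<Sum>j\<in>UNIV. coverage R i j x *
          ((rx_power R i j u - p $ (i, j)) * partial n (rx_power R i j) u))) x" .
  also have "\<dots> = - (1 / \<sigma>\<^sup>2) *
    (\<Sum>i\<in>UNIV. \<Sum>j\<in>UNIV. coverage R i j x *
      (partial m (rx_power R i j) x * partial n (rx_power R i j) x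
       + (rx_power R i j x - p $ (i, j)) * partial m (partial n (rx_power R i j)) x))"
  proof (rule partial_eqI)
    have prod: "((\<lambda>t. coverage R i j x * ((rx_power R i j (x + t *\<^sub>R axis m 1) - p $ (i, j)) *
          partial n (rx_power R i j) (x + t *\<^sub>R axis m 1))) has_real_derivative
        coverage R i j x * (partial m (rx_power R i j) x * partial n (rx_power R i j) x
          + (rx_power R i j x - p $ (i, j)) * partial m (partial n (rx_power R i j)) x)) (at 0)" for i j
    proof -
      have "((\<lambda>t. partial n (rx_power R i j) (x + t *\<^sub>R axis m 1)) has_real_derivative
          partial m (partial n (rx_power R i j)) x) (at 0)"
        by (rule has_partial_derivative[OF P(2)])
      moreover have "((\<lambda>t. rx_power R i j (x + t *\<^sub>R axis m 1)) has_real_derivative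
          partial m (rx_power R i j) x) (at 0)"
        by (intro has_partial_derivative twice_differentiable_imp_differentiable
            twice_differentiable_rx_power)
      ultimately show ?thesis
        by (auto intro!: derivative_eq_intros)
    qed
    show "((\<lambda>t. - (1 / \<sigma>\<^sup>2) * (\<Sum>i\<in>UNIV. \<Sum>j\<in>UNIV. coverage R i j x *
          ((rx_power R i j (x + t *\<^sub>R axis m 1) - p $ (i, j)) *
            partial n (rx_power R i j) (x + t *\<^sub>R axis m 1)))) has_real_derivative
        - (1 / \<sigma>\<^sup>2) * (\<Sum>i\<in>UNIV. \<Sum>j\<in>UNIV. coverage R i j x *
          (partial m (rx_power R i j) x * partial n (rx_power R i j) x
           + (rx_power R i j x - p $ (i, j)) * partial m (partial n (rx_power R i j)) x))) (at 0)"
      by (intro DERIV_cmult DERIV_sum prod)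
  qed
  finally show ?thesis .
qed

end

text \<open>The law of the noise lives on a product of function coordinates, while estimators are
  Borel on vectors. The map between the two is measurable because its coordinates are.\<close>

lemma matrix_entries_measurable:
  "(\<lambda>y. \<chi> k. y k) \<in> PiM UNIV (\<lambda>_. borel) \<rightarrow>\<^sub>M (borel :: (real ^ 'k::finite) measure)"
  by (subst borel_measurable_euclidean_space) (auto simp: Basis_vec_def inner_axis)

lemma sum_pairs: "(\<Sum>k\<in>UNIV. f k) = (\<Sum>i\<in>UNIV. \<Sum>j\<in>UNIV. f (i, j))"
  for f :: "'m::finite \<times> 'k::finite \<Rightarrow> 'b::comm_monoid_add"
  by (simp add: sum.cartesian_product)

section \<open>Fisher information and error bounds for the noisy power measurements\<close>

context
  fixes R :: "'n::finite rfid" and x :: "real ^ 2"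
    and M :: "'a measure" and \<omega> :: "'n \<times> 'n \<Rightarrow> 'a \<Rightarrow> real" and \<sigma> :: real
  assumes M: "prob_space M" and \<sigma>: "0 < \<sigma>" and noise: "gaussian_noise M \<sigma> \<omega>"
    and adm: "admissible R" and reg: "regular_at R x"
begin

interpretation prob_space M
  by (rule M)

lemma noise_indep: "indep_vars (\<lambda>_. borel) \<omega> UNIV"
  and noise_normal: "distributed M lborel (\<omega> k) (normal_density 0 \<sigma>)"
  using noise unfolding gaussian_noise_def by blast+

lemma noise_mean: "has_bochner_integral M (\<omega> k) 0"
proof -
  have "integrable lborel (\<lambda>y. normal_density 0 \<sigma> y * y)"
    using normal_moment_odd[OF \<sigma>, of 0 0] by (simp add: has_bochner_integral_iff)
  then have "integrable M (\<omega> k)"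
    by (intro distributed_integrable_var[OF noise_normal]) simp_all
  then show ?thesis
    using normal_distributed_expectation[OF \<sigma> noise_normal] by (simp add: has_bochner_integral_iff)
qed

text \<open>At the true location the residual is minus the noise, which has mean 0, so the curvature
  term disappears from the expectation.\<close>

lemma fisher_eq:
  assumes cov: "\<And>i j. \<forall>\<^sub>F u in nhds x. coverage R i j u = coverage R i j x"
  shows "fisher R \<sigma> M \<omega> x $ m $ n = 1 / \<sigma>\<^sup>2 * (\<Sum>i\<in>UNIV. \<Sum>j\<in>UNIV. coverage R i j x *
    (partial m (rx_power R i j) x * partial n (rx_power R i j) x))"
proof -
  have "partial m (partial n (\<lambda>u. ln (likelihood R \<sigma> (measured R \<omega> x w) u))) x =
      - (1 / \<sigma>\<^sup>2) * (\<Sum>i\<in>UNIV. \<Sum>j\<in>UNIV. coverage R i j x *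
        (partial m (rx_power R i j) x * partial n (rx_power R i j) x
          + - \<omega> (i, j) w * partial m (partial n (rx_power R i j)) x))" for w
    unfolding second_partial_log_likelihood[OF adm reg \<sigma> cov] by (simp add: measured_def power_vec_def)
  \<comment> \<open>The \<open>0\<close> in the stated value stands in the place of
    \<open>\<omega> (i, j) w\<close> as its mean.\<close>
  moreover have "has_bochner_integral M (\<lambda>w. - (1 / \<sigma>\<^sup>2) * (\<Sum>i\<in>UNIV. \<Sum>j\<in>UNIV. coverage R i j x *
        (partial m (rx_power R i j) x * partial n (rx_power R i j) x
          + - \<omega> (i, j) w * partial m (partial n (rx_power R i j)) x)))
      (- (1 / \<sigma>\<^sup>2) * (\<Sum>i\<in>UNIV. \<Sum>j\<in>UNIV. coverage R i j x *
        (partial m (rx_power R i j) x * partial n (rx_power R i j) x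
          + - 0 * partial m (partial n (rx_power R i j)) x)))"
    by (intro has_bochner_integral_mult_right has_bochner_integral_mult_left has_bochner_integral_sum
        has_bochner_integral_add has_bochner_integral_minus has_integral_const noise_mean)
  ultimately have "(\<integral>w. partial m (partial n (\<lambda>u. ln (likelihood R \<sigma> (measured R \<omega> x w) u))) x \<partial>M)
      = - (1 / \<sigma>\<^sup>2) * (\<Sum>i\<in>UNIV. \<Sum>j\<in>UNIV. coverage R i j x *
        (partial m (rx_power R i j) x * partial n (rx_power R i j) x
          + - 0 * partial m (partial n (rx_power R i j)) x))"
    by (simp only: has_bochner_integral_integral_eq)
  then show ?thesis
    by (simp add: fisher_def)
qed

text \<open>The mask \<open>c\<close> selects the pairs the estimator looks at: for it, moving the tag from \<open>x\<close> to \<open>u\<close> is the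
  same as shifting the selected components of the noise only.\<close>

lemma masked_cramer_rao:
  assumes c: "\<And>k. c k = 0 \<or> c k = 1"
    and S: "open S" "x \<in> S" and est: "est \<in> borel_measurable borel" "unbiased_on R M \<omega> S est"
    and masked: "\<And>u w. est (measured R \<omega> u w)
      = est (measured R \<omega> x w + (\<chi> k. c k * (rx_power R (fst k) (snd k) u - rx_power R (fst k) (snd k) x)))"
    and F: "\<And>m n. F $ m $ n = 1 / \<sigma>\<^sup>2 * (\<Sum>i\<in>UNIV. \<Sum>j\<in>UNIV. c (i, j) *
      (partial m (rx_power R i j) x * partial n (rx_power R i j) x))"
    and inv: "invertible F"
  shows "ennreal (sqrt (matrix_inv F $ 1 $ 1 + matrix_inv F $ 2 $ 2))
    \<le> rmse M (\<lambda>w. est (measured R \<omega> x w)) x"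
proof -
  define T where "T y = est (power_vec R x + (\<chi> k. y k))" for y
  define D where "D u k = c k * (rx_power R (fst k) (snd k) u - rx_power R (fst k) (snd k) x)" for u k
  define J where "J k m = c k * partial m (rx_power R (fst k) (snd k)) x" for k m
  have "(\<lambda>y. power_vec R x + (\<chi> k. y k)) \<in> PiM UNIV (\<lambda>_. borel) \<rightarrow>\<^sub>M borel"
    by (intro borel_measurable_add measurable_const matrix_entries_measurable) simp
  then have T: "T \<in> borel_measurable (PiM UNIV (\<lambda>_. borel))"
    unfolding T_def using est(1) by (rule measurable_compose)
  have "ennreal (\<Sum>m\<in>UNIV. matrix_inv F $ m $ m) \<le> (\<integral>\<^sup>+w. ennreal ((norm (T (\<lambda>k. \<omega> k w) - x))\<^sup>2) \<partial>M)"
  proof (rule gaussian_cramer_rao[OF \<sigma> noise_indep noise_normal T S])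
    \<comment> \<open>By \<open>masked\<close>, shifting the noise by \<open>D u\<close> reproduces
      the estimate from data generated at \<open>u\<close>, so unbiasedness on \<open>S\<close>
      becomes the hypothesis on shifted noise.\<close>
    have "T (\<lambda>k. \<omega> k w + D u k) = est (measured R \<omega> u w)" for u w
      unfolding masked[of u] unfolding T_def measured_def D_def
      by (rule arg_cong[where f = est]) (simp add: vec_eq_iff)
    then show "has_bochner_integral M (\<lambda>w. T (\<lambda>k. \<omega> k w + D u k)) u" if "u \<in> S" for u
      using est(2) that by (simp add: unbiased_on_def has_bochner_integral_iff)
    show "D x k = 0" for k
      by (simp add: D_def)
    show "((\<lambda>t. D (x + t *\<^sub>R axis m 1) k) has_real_derivative J k m) (at 0)" for k m
    proof -
      have "((\<lambda>t. rx_power R (fst k) (snd k) (x + t *\<^sub>R axis m 1)) has_real_derivative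
          partial m (rx_power R (fst k) (snd k)) x) (at 0)"
        by (intro has_partial_derivative twice_differentiable_imp_differentiable
            twice_differentiable_rx_power adm reg)
      then show ?thesis
        unfolding D_def J_def by (auto intro!: derivative_eq_intros)
    qed
    \<comment> \<open>The mask takes only the values 0 and 1, so its square is itself and
      \<open>J\<close> yields exactly the weights of \<open>F\<close>.\<close>
    have "J k m * J k n = c k * (partial m (rx_power R (fst k) (snd k)) x * partial n (rx_power R (fst k) (snd k)) x)" for k m n
      using c[of k] by (auto simp: J_def)
    then show "F $ m $ n = 1 / \<sigma>\<^sup>2 * (\<Sum>k\<in>UNIV. J k m * J k n)" for m n
      by (simp add: F sum_pairs)
  qed (rule inv)
  then have tr: "ennreal (matrix_inv F $ 1 $ 1 + matrix_inv F $ 2 $ 2)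
      \<le> (\<integral>\<^sup>+w. ennreal ((norm (est (measured R \<omega> x w) - x))\<^sup>2) \<partial>M)"
    by (simp add: sum_2 T_def measured_def)
  show ?thesis
  proof (cases "(\<integral>\<^sup>+w. ennreal ((norm (est (measured R \<omega> x w) - x))\<^sup>2) \<partial>M)")
    case (real v)
    with tr show ?thesis
      by (simp add: rmse_def Let_def ennreal_leI)
  next
    case top
    then show ?thesis
      by (simp add: rmse_def)
  qed
qed

end

text \<open>The coverage indicator can jump where a power meets its threshold, so the likelihood is
  differentiated under local constancy of the coverage. The bound with \<open>info_all\<close>
  refers to the law of the measurements alone and therefore holds at any coverage.\<close>

theorem theorem1:
  fixes R :: "'n::finite rfid"
    and M :: "'a measure"
    and \<omega> :: "'n \<times> 'n \<Rightarrow> 'a \<Rightarrow> real"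
    and \<sigma> :: real
    and x :: "real ^ 2"
  assumes "prob_space M"
    and "0 < \<sigma>"
    and "gaussian_noise M \<sigma> \<omega>"
    and "admissible R"
    and "regular_at R x"
  shows
    "((\<forall>i j. \<forall>\<^sub>F u in nhds x. coverage R i j u = coverage R i j x) \<longrightarrow>
       (\<forall>m n. fisher R \<sigma> M \<omega> x $ m $ n =
          1 / \<sigma>\<^sup>2 * (\<Sum>i\<in>UNIV. \<Sum>j\<in>UNIV. coverage R i j x *
            (partial m (rx_power R i j) x * partial n (rx_power R i j) x))) \<and>
       ((\<forall>i j. coverage R i j x = 1) \<longrightarrow>
          (\<forall>m n. fisher R \<sigma> M \<omega> x $ m $ n =
            1 / \<sigma>\<^sup>2 * (\<Sum>i\<in>UNIV. \<Sum>j\<in>UNIV.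
              partial m (rx_power R i j) x * partial n (rx_power R i j) x))) \<and>
       (\<forall>S est. open S \<and> x \<in> S \<and> est \<in> borel_measurable borel \<and> unbiased_on R M \<omega> S est \<and>
            uses_covered R x est \<and> invertible (fisher R \<sigma> M \<omega> x) \<longrightarrow>
          rmse M (\<lambda>w. est (measured R \<omega> x w)) x \<ge>
            ennreal (sqrt (matrix_inv (fisher R \<sigma> M \<omega> x) $ 1 $ 1
                         + matrix_inv (fisher R \<sigma> M \<omega> x) $ 2 $ 2)))) \<and>
     (\<forall>S est. open S \<and> x \<in> S \<and> est \<in> borel_measurable borel \<and> unbiased_on R M \<omega> S est \<and>
          invertible (info_all R \<sigma> x) \<longrightarrow>
        rmse M (\<lambda>w. est (measured R \<omega> x w)) x \<ge>
          ennreal (sqrt (matrix_inv (info_all R \<sigma> x) $ 1 $ 1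
                       + matrix_inv (info_all R \<sigma> x) $ 2 $ 2))) \<and>
     (\<forall>i j m. partial m (rx_power R i j) x =
          partial m (\<lambda>u. 20 * log 10 (link_const R i j)) x
        + partial m (\<lambda>u. 20 * log 10 (gainR R i u)) x
        + partial m (\<lambda>u. 20 * log 10 (gainR R j u)) x
        + partial m (\<lambda>u. 20 * log 10 (path_loss R (ddist R i u))) x
        + partial m (\<lambda>u. 20 * log 10 (path_loss R (ddist R j u))) x) \<and>
     (\<forall>i j m. partial m (rx_power R i j) x = 20 / ln 10 *
         (partial m (gainR R i) x / gainR R i x
        + partial m (gainR R j) x / gainR R j x
        + partial m (\<lambda>u. path_loss R (ddist R i u)) x / path_loss R (ddist R i x)
        + partial m (\<lambda>u. path_loss R (ddist R j u)) x / path_loss R (ddist R j x)))"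
proof (intro conjI impI allI; (elim conjE)?)
  have covI: "coverage R i j x = 0 \<or> coverage R i j x = 1" for i j
    by (simp add: coverage_def)
  {
    assume cov: "\<forall>i j. \<forall>\<^sub>F u in nhds x. coverage R i j u = coverage R i j x"
    note fisher = fisher_eq[OF assms cov[rule_format]]
    show "fisher R \<sigma> M \<omega> x $ m $ n = 1 / \<sigma>\<^sup>2 * (\<Sum>i\<in>UNIV. \<Sum>j\<in>UNIV. coverage R i j x *
        (partial m (rx_power R i j) x * partial n (rx_power R i j) x))" for m n
      by (rule fisher)
    show "fisher R \<sigma> M \<omega> x $ m $ n = 1 / \<sigma>\<^sup>2 * (\<Sum>i\<in>UNIV. \<Sum>j\<in>UNIV.
        partial m (rx_power R i j) x * partial n (rx_power R i j) x)"
      if "\<forall>i j. coverage R i j x = 1" for m n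
      unfolding fisher using that by simp
    show "ennreal (sqrt (matrix_inv (fisher R \<sigma> M \<omega> x) $ 1 $ 1 + matrix_inv (fisher R \<sigma> M \<omega> x) $ 2 $ 2))
        \<le> rmse M (\<lambda>w. est (measured R \<omega> x w)) x"
      if "open S" "x \<in> S" "est \<in> borel_measurable borel" "unbiased_on R M \<omega> S est"
        "uses_covered R x est" "invertible (fisher R \<sigma> M \<omega> x)" for S est
    proof (rule masked_cramer_rao[OF assms, where c = "\<lambda>k. coverage R (fst k) (snd k) x"])
      \<comment> \<open>The mask is the coverage at \<open>x\<close>, also for data from
        \<open>u\<close>. On covered pairs it is 1 and both vectors agree; the estimator ignores the
        other pairs.\<close>
      show "est (measured R \<omega> u w) = est (measured R \<omega> x w + (\<chi> k. coverage R (fst k) (snd k) x *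
          (rx_power R (fst k) (snd k) u - rx_power R (fst k) (snd k) x)))" for u w
        using \<open>uses_covered R x est\<close>[unfolded uses_covered_def]
        by (elim allE impE) (auto simp: measured_def power_vec_def)
    qed (use that covI in \<open>simp_all add: fisher\<close>)
  }
  show "ennreal (sqrt (matrix_inv (info_all R \<sigma> x) $ 1 $ 1 + matrix_inv (info_all R \<sigma> x) $ 2 $ 2))
      \<le> rmse M (\<lambda>w. est (measured R \<omega> x w)) x"
    if "open S" "x \<in> S" "est \<in> borel_measurable borel" "unbiased_on R M \<omega> S est"
      "invertible (info_all R \<sigma> x)" for S est
  \<comment> \<open>With the constant mask 1 the shift is the full change of the power vector, so
    every estimator qualifies.\<close>
  proof (rule masked_cramer_rao[OF assms, where c = "\<lambda>_. 1"])
    show "est (measured R \<omega> u w) = est (measured R \<omega> x w + (\<chi> k. 1 *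
        (rx_power R (fst k) (snd k) u - rx_power R (fst k) (snd k) x)))" for u w
      by (rule arg_cong[where f = est]) (simp add: measured_def power_vec_def vec_eq_iff)
  qed (use that in \<open>simp_all add: info_all_def\<close>)
  show "partial m (rx_power R i j) x = 20 / ln 10 *
       (partial m (gainR R i) x / gainR R i x
      + partial m (gainR R j) x / gainR R j x
      + partial m (\<lambda>u. path_loss R (ddist R i u)) x / path_loss R (ddist R i x)
      + partial m (\<lambda>u. path_loss R (ddist R j u)) x / path_loss R (ddist R j x))" for i j m
    by (rule partial_rx_power[OF assms(4,5)])
  show "partial m (rx_power R i j) x =
        partial m (\<lambda>u. 20 * log 10 (link_const R i j)) x
      + partial m (\<lambda>u. 20 * log 10 (gainR R i u)) x
      + partial m (\<lambda>u. 20 * log 10 (gainR R j u)) x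
      + partial m (\<lambda>u. 20 * log 10 (path_loss R (ddist R i u))) x
      + partial m (\<lambda>u. 20 * log 10 (path_loss R (ddist R j u))) x" for i j m
    unfolding partial_rx_power[OF assms(4,5)] partial_gain_dB[OF assms(4,5)]
      partial_path_loss_dB[OF assms(4,5)] partial_eqI[OF DERIV_const]
    by (simp add: distrib_left)
qed

end
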